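(* Let $\mathcal A$ be an action set, $\mathcal F$ a class of functions $f:\mathcal A\to[-1,1]$, $\mathcal Z=\mathcal F\times\mathcal A$, $\rho=\rho_{\mathrm{bandits}}$, $\epsilon>0$ and $\alpha\le\alpha^*$. Then $$\overline{\mathtt d}_\rho(\mathcal Z,\alpha,3\epsilon/2)\le9\,\overline{\mathtt{dim}}_{\mathrm E}(\mathcal F,\epsilon).$$
   Context: Bandit evaluation function: $\rho_{\mathrm{bandits}}\bigl((f,a)\mid(f',a')\bigr)=f'(a)$. There is a target reward function $f^*\in\mathcal F$ with optimal action $a^*=\arg\max_{a\in\mathcal A}f^*(a)$, and $\alpha^*=f^*(a^* )$. Dissimilarity dimension: for $\alpha\in\mathbb R$, $\epsilon>0$, $\mathtt d_\rho(\mathcal Z,\alpha,\epsilon)$ is the largest integer $d$ for which there exist $z_1,\dots,z_d\in\mathcal Z$ with $\rho(z_i\mid z_i)\ge\alpha$ for all $i$, and a scalar $c\le\alpha-\epsilon$, such that $|\rho(z_i\mid z_j)-c|\le\epsilon/\sqrt d$ for all $i<j$. The monotonic version is $\overline{\mathtt d}_\rho(\mathcal Z,\alpha,\epsilon)=\max_{\epsilon'\ge\epsilon}\mathtt d_\rho(\mathcal Z,\alpha,\epsilon')$. Eluder dimension: an action $a\in\mathcal A$ is $\epsilon$-dependent on actions $\{a_1,\dots,a_n\}\subseteq\mathcal A$ with respect to $\mathcal F$ if any pair $f,f'\in\mathcal F$ with $\sqrt{\sum_{i=1}^n(f(a_i)-f'(a_i))^2}\le\epsilon$ also satisfies $|f(a)-f'(a)|\le\epsilon$;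 otherwise it is $\epsilon$-independent of them. $\mathtt{dim}_{\mathrm E}(\mathcal F,\epsilon)$ is the length of the longest sequence of elements of $\mathcal A$ such that every element is $\epsilon$-independent of its predecessors, and $\overline{\mathtt{dim}}_{\mathrm E}(\mathcal F,\epsilon)=\max_{\epsilon'\ge\epsilon}\mathtt{dim}_{\mathrm E}(\mathcal F,\epsilon')$. *)

theory Defs
  imports Complex_Main "HOL-Library.Extended_Nat" "HOL-Library.FuncSet"
begin

text \<open>An evaluation function \<open>\<rho>(z | z')\<close> is written \<open>\<rho> z z'\<close>. All dimensions take values in
  \<^typ>\<open>enat\<close>: the supremum below is the largest admissible length when there is one, and
  \<open>\<infinity>\<close> when admissible lengths are unbounded.\<close>

definition rho_bandits :: "('a \<Rightarrow> real) \<times> 'a \<Rightarrow> ('a \<Rightarrow> real) \<times> 'a \<Rightarrow> real" where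
  "rho_bandits z z' = fst z' (snd z)"

definition dissimilar_seq ::
    "('z \<Rightarrow> 'z \<Rightarrow> real) \<Rightarrow> 'z set \<Rightarrow> real \<Rightarrow> real \<Rightarrow> nat \<Rightarrow> (nat \<Rightarrow> 'z) \<Rightarrow> bool" where
  "dissimilar_seq \<rho> Z \<alpha> \<epsilon> d z \<longleftrightarrow>
     (\<forall>i\<in>{1..d}. z i \<in> Z \<and> \<rho> (z i) (z i) \<ge> \<alpha>) \<and>
     (\<exists>c\<le>\<alpha> - \<epsilon>. \<forall>j\<in>{1..d}. \<forall>i\<in>{1..<j}. \<bar>\<rho> (z i) (z j) - c\<bar> \<le> \<epsilon> / sqrt (real d))"

definition dissim_dim :: "('z \<Rightarrow> 'z \<Rightarrow> real) \<Rightarrow> 'z set \<Rightarrow> real \<Rightarrow> real \<Rightarrow> enat" where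
  "dissim_dim \<rho> Z \<alpha> \<epsilon> = Sup {enat d | d. \<exists>z. dissimilar_seq \<rho> Z \<alpha> \<epsilon> d z}"

definition mono_dissim_dim :: "('z \<Rightarrow> 'z \<Rightarrow> real) \<Rightarrow> 'z set \<Rightarrow> real \<Rightarrow> real \<Rightarrow> enat" where
  "mono_dissim_dim \<rho> Z \<alpha> \<epsilon> = (SUP \<epsilon>'\<in>{\<epsilon>..}. dissim_dim \<rho> Z \<alpha> \<epsilon>')"

text \<open>Dependence is a relation to a nonempty list \<open>a\<^sub>1, \<dots>, a\<^sub>n\<close> (\<open>n \<ge> 1\<close>), so the first
  element of a sequence, having no predecessors, is independent of them vacuously. Hence the
  eluder dimension is at least 1 when there is an action. If one instead read the condition with
  an empty sum, a singleton function class would have eluder dimension 0, while its dissimilarity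
  dimension at a level it attains is at least 1.\<close>

definition eps_dependent :: "('a \<Rightarrow> real) set \<Rightarrow> real \<Rightarrow> 'a \<Rightarrow> 'a list \<Rightarrow> bool" where
  "eps_dependent F \<epsilon> a as \<longleftrightarrow> as \<noteq> [] \<and>
     (\<forall>f\<in>F. \<forall>f'\<in>F. sqrt (\<Sum>b\<leftarrow>as. (f b - f' b)\<^sup>2) \<le> \<epsilon> \<longrightarrow> \<bar>f a - f' a\<bar> \<le> \<epsilon>)"

definition eluder_seq :: "'a set \<Rightarrow> ('a \<Rightarrow> real) set \<Rightarrow> real \<Rightarrow> 'a list \<Rightarrow> bool" where
  "eluder_seq A F \<epsilon> as \<longleftrightarrow>
     set as \<subseteq> A \<and> (\<forall>k<length as. \<not> eps_dependent F \<epsilon> (as ! k) (take k as))"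

definition eluder_dim :: "'a set \<Rightarrow> ('a \<Rightarrow> real) set \<Rightarrow> real \<Rightarrow> enat" where
  "eluder_dim A F \<epsilon> = Sup {enat (length as) | as. eluder_seq A F \<epsilon> as}"

definition mono_eluder_dim :: "'a set \<Rightarrow> ('a \<Rightarrow> real) set \<Rightarrow> real \<Rightarrow> enat" where
  "mono_eluder_dim A F \<epsilon> = (SUP \<epsilon>'\<in>{\<epsilon>..}. eluder_dim A F \<epsilon>')"

end

theory Submission
  imports Defs
begin

text \<open>Let \<open>z\<^sub>i = (f\<^sub>i, a\<^sub>i)\<close>, \<open>i \<le> d\<close>, be dissimilar at scale \<open>\<epsilon>\<close>. The last function
  \<open>f\<^sub>d\<close> is close to \<open>c\<close> at every earlier action, whereas \<open>f\<^sub>k a\<^sub>k \<ge> c + \<epsilon>\<close>. So \<open>f\<^sub>k\<close> and \<open>f\<^sub>d\<close>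
  differ by at least \<open>\<epsilon> - \<epsilon> / \<surd>d\<close> at \<open>a\<^sub>k\<close>, which exceeds \<open>2 \<epsilon> / 3\<close> once \<open>d > 9\<close>, while on
  \<open>a\<^sub>1, \<dots>, a\<^bsub>k-1\<^esub>\<close> they differ in the Euclidean norm by at most \<open>2 \<epsilon> \<surd>((k - 1) / d)\<close>, which
  is at most \<open>2 \<epsilon> / 3\<close> for \<open>k - 1 \<le> d / 9\<close>. Hence the first \<open>\<lfloor>d / 9\<rfloor> + 1\<close> actions form an
  eluder sequence at scale \<open>2 \<epsilon> / 3\<close>. If \<open>d \<le> 9\<close>, a single action suffices.\<close>

text \<open>The only predecessor list is empty, and \<open>eps_dependent\<close> excludes the empty
  list.\<close>

lemma eluder_seq_singleton: "a \<in> A \<Longrightarrow> eluder_seq A F \<epsilon> [a]"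
  by (simp add: eluder_seq_def eps_dependent_def)

lemma eluder_seq_of_dissimilar_seq:
  assumes "dissimilar_seq rho_bandits (F \<times> A) \<alpha> \<epsilon> d z" and "\<epsilon> > 0" and "d > 9"
  shows "eluder_seq A F (2 * \<epsilon> / 3) (map (\<lambda>i. snd (z i)) [1..<d div 9 + 2])"
proof -
  have Z: "fst (z i) \<in> F" "snd (z i) \<in> A" "fst (z i) (snd (z i)) \<ge> \<alpha>" if "1 \<le> i" "i \<le> d" for i
    using assms(1) that by (auto simp: dissimilar_seq_def rho_bandits_def mem_Times_iff)
  obtain c where c: "c \<le> \<alpha> - \<epsilon>"
    and near: "\<And>i j. \<lbrakk>1 \<le> i; i < j; j \<le> d\<rbrakk> \<Longrightarrow>
      \<bar>fst (z j) (snd (z i)) - c\<bar> \<le> \<epsilon> / sqrt (real d)"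
    using assms(1) by (auto simp: dissimilar_seq_def rho_bandits_def)
  have "sqrt (real d) > sqrt (3\<^sup>2)"
    using assms(3) by (subst real_sqrt_less_iff) simp
  then have small: "\<epsilon> / sqrt (real d) < \<epsilon> / 3"
    using assms(2,3) by (intro divide_strict_left_mono) auto
  \<comment> \<open>List positions start at 0 and \<open>z\<close> at 1: position \<open>k\<close>
    holds the action of \<open>z (Suc k)\<close>, preceded by those of \<open>z 1\<close> to
    \<open>z k\<close>.\<close>
  have "\<not> eps_dependent F (2 * \<epsilon> / 3) (snd (z (Suc k))) (map (\<lambda>i. snd (z i)) [1..<Suc k])"
    if k: "k \<le> d div 9" for k
  proof -
    have kd: "Suc k < d" "9 * real k \<le> real d"
      using k assms(3) by linarith+
    let ?f = "fst (z (Suc k))" and ?g = "fst (z d)"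
    have "\<bar>?f (snd (z i)) - ?g (snd (z i))\<bar> \<le> 2 * (\<epsilon> / sqrt (real d))"
      if "i \<in> {1..<Suc k}" for i
      \<comment> \<open>Triangle inequality through \<open>c\<close>; both functions have index
        above \<open>i\<close>.\<close>
      using near[of i "Suc k"] near[of i d] that kd by auto
    then have "(\<Sum>i\<in>{1..<Suc k}. (?f (snd (z i)) - ?g (snd (z i)))\<^sup>2)
        \<le> (\<Sum>i\<in>{1..<Suc k}. (2 * (\<epsilon> / sqrt (real d)))\<^sup>2)"
      by (intro sum_mono abs_le_square_iff[THEN iffD1] order_trans[OF _ abs_ge_self])
    also have "\<dots> = 4 * \<epsilon>\<^sup>2 * (real k / real d)"
      by (simp add: power_mult_distrib power_divide)
    also have "\<dots> \<le> 4 * \<epsilon>\<^sup>2 * (1 / 9)"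
      using kd by (intro mult_left_mono) (auto simp: field_simps)
    also have "\<dots> = (2 * \<epsilon> / 3)\<^sup>2"
      by (simp add: power2_eq_square)
    finally have "sqrt (\<Sum>b\<leftarrow>map (\<lambda>i. snd (z i)) [1..<Suc k]. (?f b - ?g b)\<^sup>2) \<le> 2 * \<epsilon> / 3"
      using assms(2) by (intro real_le_lsqrt) (auto simp: interv_sum_list_conv_sum_set_nat o_def
        simp del: upt_Suc intro!: sum_nonneg)
    moreover have "\<bar>?f (snd (z (Suc k))) - ?g (snd (z (Suc k)))\<bar> > 2 * \<epsilon> / 3"
      using near[of "Suc k" d] Z(3)[of "Suc k"] c small kd(1) by linarith
    moreover have "?f \<in> F" "?g \<in> F"
      using Z(1) kd by auto
    ultimately show ?thesis
      unfolding eps_dependent_def by (meson not_le)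
  qed
  moreover have "d div 9 + 1 \<le> d"
    using assms(3) by linarith
  ultimately show ?thesis
    using Z(2) by (auto simp: eluder_seq_def take_map simp del: upt_Suc)
qed

lemma ex_eluder_seq_of_dissimilar_seq:
  assumes "dissimilar_seq rho_bandits (F \<times> A) \<alpha> \<epsilon> d z" and "\<epsilon> > 0"
  shows "\<exists>as. eluder_seq A F (2 * \<epsilon> / 3) as \<and> d \<le> 9 * length as"
proof -
  consider "d = 0" | "0 < d" "d \<le> 9" | "d > 9"
    by linarith
  then show ?thesis
  proof cases
    case 1
    then show ?thesis
      by (intro exI[of _ "[]"]) (simp add: eluder_seq_def)
  next
    case 2
    then have "snd (z 1) \<in> A"
      using assms(1) by (auto simp: dissimilar_seq_def mem_Times_iff)
    then show ?thesis
      using 2 by (intro exI[of _ "[snd (z 1)]"]) (simp add: eluder_seq_singleton)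
  next
    case 3
    \<comment> \<open>Rounding down in \<open>d div 9\<close> is made up for by the one extra
      action.\<close>
    moreover have "d \<le> 9 * (d div 9 + 1)"
      by presburger
    ultimately show ?thesis
      using eluder_seq_of_dissimilar_seq[OF assms 3]
      by (intro exI conjI) (assumption, simp del: upt_Suc)
  qed
qed

lemma length_le_mono_eluder_dim:
  assumes "eluder_seq A F \<epsilon>' as" and "\<epsilon> \<le> \<epsilon>'"
  shows "enat (length as) \<le> mono_eluder_dim A F \<epsilon>"
proof -
  have "enat (length as) \<le> eluder_dim A F \<epsilon>'"
    unfolding eluder_dim_def using assms(1) by (intro Sup_upper) blast
  also have "\<dots> \<le> mono_eluder_dim A F \<epsilon>"
    unfolding mono_eluder_dim_def using assms(2) by (intro SUP_upper) simp
  finally show ?thesis .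
qed

theorem theorem11:
  fixes A :: "'a set" and F :: "('a \<Rightarrow> real) set"
    and fstar :: "'a \<Rightarrow> real" and astar :: 'a and \<alpha> \<epsilon> :: real
  assumes "F \<subseteq> A \<rightarrow> {-1..1}"
    and "fstar \<in> F"
    and "is_arg_max fstar (\<lambda>a. a \<in> A) astar"
    and "\<epsilon> > 0"
    and "\<alpha> \<le> fstar astar"
  shows "mono_dissim_dim rho_bandits (F \<times> A) \<alpha> (3 * \<epsilon> / 2) \<le> 9 * mono_eluder_dim A F \<epsilon>"
proof -
  have "enat d \<le> 9 * mono_eluder_dim A F \<epsilon>"
    if \<epsilon>': "3 * \<epsilon> / 2 \<le> \<epsilon>'" and z: "dissimilar_seq rho_bandits (F \<times> A) \<alpha> \<epsilon>' d z" for \<epsilon>' d z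
  proof -
    \<comment> \<open>The factor 3/2 is chosen so that \<open>2 * \<epsilon>' / 3\<close> is at
      least \<open>\<epsilon>\<close>, a scale the monotonic eluder dimension ranges over.\<close>
    obtain as where as: "eluder_seq A F (2 * \<epsilon>' / 3) as" "d \<le> 9 * length as"
      using ex_eluder_seq_of_dissimilar_seq[OF z] \<epsilon>' assms(4) by auto
    have "enat d \<le> 9 * enat (length as)"
      using as(2) by (simp add: numeral_eq_enat)
    also have "\<dots> \<le> 9 * mono_eluder_dim A F \<epsilon>"
      using length_le_mono_eluder_dim[OF as(1), of \<epsilon>] \<epsilon>' by (intro mult_left_mono) auto
    finally show ?thesis .
  qed
  then show ?thesis
    unfolding mono_dissim_dim_def dissim_dim_def by (intro SUP_least Sup_least) auto
qed

end
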